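(* Let $\mathcal B$ be a countable set, $\mathbf{ex}\subseteq\mathcal B$, $\beta\colon\mathbb Z[\mathbf{ex}]\to\mathbb Z[\mathcal B]^*$ skew-symmetrizable and $\lambda\colon\mathbb Z[\mathcal B]^*\to\mathbb Z[\mathcal B]$ skew-symmetric and compatible with $\beta$. Let $k\in\mathbf{ex}$. Then the maps $\mu_k\beta\colon\mathbb Z[\mu_k(\mathbf{ex})]\to\mathbb Z[\mu_k(\mathcal B)]^*$ and $\mu_k\lambda\colon\mathbb Z[\mu_k(\mathcal B)]^*\to\mathbb Z[\mu_k(\mathcal B)]$ are compatible.
   Context: $\mathbb Z[S]$ is the free abelian group on $S$; $\mathbb Z[\mathcal B]^*$ is identified with the free abelian group on the dual basis $\{b^*\mid b\in\mathcal B\}$, $b^*(c)=\delta_{bc}$. $[n]_+=\max(n,0)$, $[\sum v_bb^*]_+=\sum[v_b]_+b^*$. Put $\langle v,w\rangle_\beta=\beta(v)(w)$ ($v\in\mathbb Z[\mathbf{ex}],w\in\mathbb Z[\mathcal B]$) and $\langle v,w\rangle_\lambda=w(\lambda(v))$ ($v,w\in\mathbb Z[\mathcal B]^*$). $\beta$ is skew-symmetrizable if $\langle-,-\rangle_\beta$ restricted to $\mathbb Z[\mathbf{ex}]\times\mathbb Z[\mathbf{ex}]$ is skew-symmetric; $\lambda$ is skew-symmetric if $\langle-,-\rangle_\lambda$ is. $\beta$ and $\lambda$ are compatible if $\lambda^*\circ\beta=\delta\circ\iota$, where $\iota\colon\mathbb Z[\mathbf{ex}]\hookrightarrow\mathbb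 Z[\mathcal B]$ is the inclusion and $\delta\colon\mathbb Z[\mathcal B]\to\mathbb Z[\mathcal B]^{**}$ is evaluation; equivalently $\beta(k)(\lambda(b^* ))=\delta_{bk}$ for all $b\in\mathcal B,k\in\mathbf{ex}$. For $k\in\mathbf{ex}$, $\mu_{\mathcal B}(k)$ is a new symbol not in $\mathcal B$, $\mu_k(\mathcal B)=(\mathcal B\setminus\{k\})\cup\{\mu_{\mathcal B}(k)\}$, $\mu_k(\mathbf{ex})=(\mathbf{ex}\setminus\{k\})\cup\{\mu_{\mathcal B}(k)\}$. Isomorphisms: $\mu_k^+\colon\mathbb Z[\mathcal B]\to\mathbb Z[\mu_k(\mathcal B)]$, $b\mapsto b+[\langle k,b\rangle_\beta]_+\mu_{\mathcal B}(k)$ ($b\ne k$), $k\mapsto-\mu_{\mathcal B}(k)$, with inverse $\bar\mu_k^+$: $b\mapsto b+[\langle k,b\rangle_\beta]_+k$ ($b\neq\mu_{\mathcal B}(k)$), $\mu_{\mathcal B}(k)\mapsto-k$ (these restrict to $\mathbb Z[\mathbf{ex}]\leftrightarrow\mathbb Z[\mu_k(\mathbf{ex})]$); and $\mu_k^+\colon\mathbb Z[\mathcal B]^*\to\mathbb Z[\mu_k(\mathcal B)]^*$, $b^*\mapsto b^*$ ($b\ne k$), $k^*\mapsto[\beta(k)]_+-\mu_{\mathcal B}(k)^*$, with inverse $\bar\mu_k^+$: $b^*\mapsto b^*$, $\mu_{\mathcal B}(k)^*\mapsto[\beta(k)]_+-k^*$. Then $\mu_k\beta$ is defined by $\langle v,w\rangle_{\mu_k\beta}=\langle\bar\mu_k^+v,\bar\mu_k^+w\rangle_\beta$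 (equivalently $\mu_k\beta=\mu_k^+\circ\beta\circ\bar\mu_k^+$) and $\mu_k\lambda$ by $\langle v,w\rangle_{\mu_k\lambda}=\langle\bar\mu_k^+v,\bar\mu_k^+w\rangle_\lambda$ (equivalently $\mu_k\lambda=\mu_k^+\circ\lambda\circ\bar\mu_k^+$). *)

theory Defs
  imports
    "HOL-Library.Countable_Set"
    "HOL-Algebra.Free_Abelian_Groups"
begin

text \<open>
  The group \<open>\<int>[S]\<close> is \<^term>\<open>free_Abelian_group S\<close>, whose elements are the finitely supported
  functions with keys in \<open>S\<close>. For infinite \<open>B\<close> the dual \<open>\<int>[B]\<^sup>*\<close> is understood as the free
  abelian group on the dual basis (not as the group of all homomorphisms to the integers). Its basis
  element \<open>b\<^sup>*\<close> is \<open>frag_of (Dual b)\<close>; the pairing with \<open>\<int>[B]\<close> is \<open>dual_app\<close> below.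
\<close>

datatype 'a dual = Dual (undual: 'a)

definition dual_group :: "'a set \<Rightarrow> ('a dual \<Rightarrow>\<^sub>0 int) monoid" where
  "dual_group B = free_Abelian_group (Dual ` B)"

definition dual_app :: "('a dual \<Rightarrow>\<^sub>0 int) \<Rightarrow> ('a \<Rightarrow>\<^sub>0 int) \<Rightarrow> int" where
  "dual_app f x =
     (\<Sum>b\<in>Poly_Mapping.keys x. Poly_Mapping.lookup f (Dual b) * Poly_Mapping.lookup x b)"

lemma dual_app_basis: "dual_app (frag_of (Dual b)) (frag_of c) = (if b = c then 1 else 0)"
  by (simp add: dual_app_def keys_frag_of)

text \<open>The positive part \<open>[\<Sum> v\<^sub>b b\<^sup>*]\<^sub>+ = \<Sum> max v\<^sub>b 0 b\<^sup>*\<close>.\<close>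

definition pos_part :: "('a \<Rightarrow>\<^sub>0 int) \<Rightarrow> ('a \<Rightarrow>\<^sub>0 int)" where
  "pos_part v = Poly_Mapping.map (\<lambda>n. max n 0) v"

definition beta_form ::
  "(('a \<Rightarrow>\<^sub>0 int) \<Rightarrow> ('a dual \<Rightarrow>\<^sub>0 int)) \<Rightarrow> ('a \<Rightarrow>\<^sub>0 int) \<Rightarrow> ('a \<Rightarrow>\<^sub>0 int) \<Rightarrow> int" where
  "beta_form \<beta> v w = dual_app (\<beta> v) w"

definition lambda_form ::
  "(('a dual \<Rightarrow>\<^sub>0 int) \<Rightarrow> ('a \<Rightarrow>\<^sub>0 int)) \<Rightarrow> ('a dual \<Rightarrow>\<^sub>0 int) \<Rightarrow> ('a dual \<Rightarrow>\<^sub>0 int) \<Rightarrow> int" where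
  "lambda_form l v w = dual_app w (l v)"

text \<open>Following the source, skew-symmetrizability asks for genuine skew-symmetry on
  \<open>\<int>[ex] \<times> \<int>[ex]\<close>.\<close>

definition skew_symmetrizable ::
  "'a set \<Rightarrow> (('a \<Rightarrow>\<^sub>0 int) \<Rightarrow> ('a dual \<Rightarrow>\<^sub>0 int)) \<Rightarrow> bool" where
  "skew_symmetrizable ex \<beta> \<longleftrightarrow>
     (\<forall>v\<in>carrier (free_Abelian_group ex). \<forall>w\<in>carrier (free_Abelian_group ex).
        beta_form \<beta> v w = - beta_form \<beta> w v)"

definition skew_symmetric ::
  "'a set \<Rightarrow> (('a dual \<Rightarrow>\<^sub>0 int) \<Rightarrow> ('a \<Rightarrow>\<^sub>0 int)) \<Rightarrow> bool" where
  "skew_symmetric B l \<longleftrightarrow>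
     (\<forall>v\<in>carrier (dual_group B). \<forall>w\<in>carrier (dual_group B).
        lambda_form l v w = - lambda_form l w v)"

text \<open>Elements of \<open>\<int>[B]\<^sup>*\<^sup>*\<close> are integer-valued functions on \<open>\<int>[B]\<^sup>*\<close>; they are equal if they
  agree on the carrier of \<open>\<int>[B]\<^sup>*\<close>. With this, \<open>compatible\<close> states \<open>\<lambda>\<^sup>* \<circ> \<beta> = \<delta> \<circ> \<iota>\<close>.\<close>

definition transpose_map ::
  "(('a dual \<Rightarrow>\<^sub>0 int) \<Rightarrow> ('a \<Rightarrow>\<^sub>0 int)) \<Rightarrow> ('a dual \<Rightarrow>\<^sub>0 int) \<Rightarrow> (('a dual \<Rightarrow>\<^sub>0 int) \<Rightarrow> int)" where
  "transpose_map l g = (\<lambda>f. dual_app g (l f))"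

definition evaluation :: "('a \<Rightarrow>\<^sub>0 int) \<Rightarrow> (('a dual \<Rightarrow>\<^sub>0 int) \<Rightarrow> int)" where
  "evaluation x = (\<lambda>f. dual_app f x)"

definition compatible ::
  "'a set \<Rightarrow> 'a set \<Rightarrow> (('a \<Rightarrow>\<^sub>0 int) \<Rightarrow> ('a dual \<Rightarrow>\<^sub>0 int)) \<Rightarrow>
   (('a dual \<Rightarrow>\<^sub>0 int) \<Rightarrow> ('a \<Rightarrow>\<^sub>0 int)) \<Rightarrow> bool" where
  "compatible B ex \<beta> l \<longleftrightarrow>
     (\<forall>v\<in>carrier (free_Abelian_group ex). \<forall>f\<in>carrier (dual_group B).
        transpose_map l (\<beta> v) f = evaluation v f)"

text \<open>In the following, \<open>k'\<close> is the new symbol \<open>\<mu>\<^sub>B(k)\<close>. It is an arbitrary element of the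
  ambient type; that it lies outside \<open>B\<close> is assumed where needed. The maps
  are given on basis elements and extended linearly to the whole ambient type; only their values on
  the relevant subgroups matter.\<close>

definition mutate_set :: "'a \<Rightarrow> 'a \<Rightarrow> 'a set \<Rightarrow> 'a set" where
  "mutate_set k k' S = (S - {k}) \<union> {k'}"

context
  fixes \<beta> :: "('a \<Rightarrow>\<^sub>0 int) \<Rightarrow> ('a dual \<Rightarrow>\<^sub>0 int)" and k k' :: 'a
begin

definition mu_plus :: "('a \<Rightarrow>\<^sub>0 int) \<Rightarrow> ('a \<Rightarrow>\<^sub>0 int)" where
  "mu_plus = frag_extend (\<lambda>b. if b = k then - frag_of k'
     else frag_of b + frag_cmul (max (beta_form \<beta> (frag_of k) (frag_of b)) 0) (frag_of k'))"

definition mu_bar :: "('a \<Rightarrow>\<^sub>0 int) \<Rightarrow> ('a \<Rightarrow>\<^sub>0 int)" where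
  "mu_bar = frag_extend (\<lambda>b. if b = k' then - frag_of k
     else frag_of b + frag_cmul (max (beta_form \<beta> (frag_of k) (frag_of b)) 0) (frag_of k))"

definition mu_plus_dual :: "('a dual \<Rightarrow>\<^sub>0 int) \<Rightarrow> ('a dual \<Rightarrow>\<^sub>0 int)" where
  "mu_plus_dual = frag_extend (\<lambda>d. if d = Dual k
     then pos_part (\<beta> (frag_of k)) - frag_of (Dual k') else frag_of d)"

definition mu_bar_dual :: "('a dual \<Rightarrow>\<^sub>0 int) \<Rightarrow> ('a dual \<Rightarrow>\<^sub>0 int)" where
  "mu_bar_dual = frag_extend (\<lambda>d. if d = Dual k'
     then pos_part (\<beta> (frag_of k)) - frag_of (Dual k) else frag_of d)"

definition mutate_beta :: "('a \<Rightarrow>\<^sub>0 int) \<Rightarrow> ('a dual \<Rightarrow>\<^sub>0 int)" where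
  "mutate_beta = mu_plus_dual \<circ> \<beta> \<circ> mu_bar"

definition mutate_lambda ::
  "(('a dual \<Rightarrow>\<^sub>0 int) \<Rightarrow> ('a \<Rightarrow>\<^sub>0 int)) \<Rightarrow> ('a dual \<Rightarrow>\<^sub>0 int) \<Rightarrow> ('a \<Rightarrow>\<^sub>0 int)" where
  "mutate_lambda l = mu_plus \<circ> l \<circ> mu_bar_dual"

end

text \<open>
  The lemmas \<open>beta_form_mutate\<close> and \<open>lambda_form_mutate\<close> below show that these composites satisfy
  the equations \<open>\<langle>v,w\<rangle> = \<langle>\<mu>_bar v, \<mu>_bar w\<rangle>\<close> that define the mutated forms.
\<close>

lemma dual_app_superset:
  assumes "finite S" "Poly_Mapping.keys x \<subseteq> S"
  shows "dual_app f x = (\<Sum>b\<in>S. Poly_Mapping.lookup f (Dual b) * Poly_Mapping.lookup x b)"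
  unfolding dual_app_def
  by (rule sum.mono_neutral_left) (use assms in \<open>auto simp: in_keys_iff\<close>)

lemma dual_app_zero [simp]: "dual_app 0 x = 0" "dual_app f 0 = 0"
  by (simp_all add: dual_app_def)

lemma dual_app_diff_left: "dual_app (f - g) x = dual_app f x - dual_app g x"
  by (simp add: dual_app_def lookup_minus left_diff_distrib sum_subtractf)

lemma dual_app_diff_right: "dual_app f (x - y) = dual_app f x - dual_app f y"
proof -
  let ?S = "Poly_Mapping.keys x \<union> Poly_Mapping.keys y"
  have "Poly_Mapping.keys (x - y) \<subseteq> ?S" by (rule keys_diff)
  then show ?thesis
    by (simp add: dual_app_superset[of ?S] lookup_minus right_diff_distrib sum_subtractf)
qed

lemma dual_app_minus_right: "dual_app f (- x) = - dual_app f x"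
  using dual_app_diff_right[of f 0 x] by simp

lemma dual_app_add_right: "dual_app f (x + y) = dual_app f x + dual_app f y"
  using dual_app_diff_right[of f x "- y"] by (simp add: dual_app_minus_right)

lemma dual_app_cmul_right: "dual_app f (frag_cmul c x) = c * dual_app f x"
proof -
  have "Poly_Mapping.keys (frag_cmul c x) \<subseteq> Poly_Mapping.keys x" by (rule keys_cmul)
  then show ?thesis
    by (simp add: dual_app_superset[of "Poly_Mapping.keys x"] sum_distrib_left mult_ac)
qed

lemma dual_app_frag_of: "dual_app f (frag_of b) = Poly_Mapping.lookup f (Dual b)"
  by (simp add: dual_app_def keys_frag_of)

lemma lookup_pos_part: "Poly_Mapping.lookup (pos_part v) b = max (Poly_Mapping.lookup v b) 0"
  by (simp add: pos_part_def Poly_Mapping.map.rep_eq when_def)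

lemmas dual_app_simps =
  dual_app_frag_of dual_app_diff_left dual_app_diff_right dual_app_minus_right
  dual_app_add_right dual_app_cmul_right lookup_pos_part lookup_minus

lemma dual_app_eqI:
  fixes F :: "('a dual \<Rightarrow>\<^sub>0 int) \<Rightarrow> ('b dual \<Rightarrow>\<^sub>0 int)" and G :: "('b \<Rightarrow>\<^sub>0 int) \<Rightarrow> ('a \<Rightarrow>\<^sub>0 int)"
  assumes F: "F 0 = 0" "\<And>a b. F (a - b) = F a - F b"
    and G: "G 0 = 0" "\<And>a b. G (a - b) = G a - G b"
    and basis: "\<And>b c. b \<in> B \<Longrightarrow> c \<in> C \<Longrightarrow>
      dual_app (F (frag_of (Dual b))) (frag_of c) = dual_app (frag_of (Dual b)) (G (frag_of c))"
    and g: "Poly_Mapping.keys g \<subseteq> Dual ` B" and x: "Poly_Mapping.keys x \<subseteq> C"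
  shows "dual_app (F g) x = dual_app g (G x)"
proof -
  have 1: "dual_app (F (frag_of (Dual b))) x = dual_app (frag_of (Dual b)) (G x)" if "b \<in> B" for b
    using x by (induction x rule: frag_induction)
      (simp_all add: F G basis that dual_app_diff_right)
  show ?thesis
    using g by (induction g rule: frag_induction)
      (auto simp: F G 1 dual_app_diff_left)
qed

lemma beta_diag_zero:
  assumes "skew_symmetrizable ex \<beta>" "k \<in> ex"
  shows "Poly_Mapping.lookup (\<beta> (frag_of k)) (Dual k) = 0"
proof -
  have "frag_of k \<in> carrier (free_Abelian_group ex)"
    using assms(2) by (simp add: keys_frag_of)
  then have "beta_form \<beta> (frag_of k) (frag_of k) = - beta_form \<beta> (frag_of k) (frag_of k)"
    using assms(1) unfolding skew_symmetrizable_def by blast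
  then show ?thesis by (simp add: beta_form_def dual_app_frag_of)
qed

lemma beta_new_zero:
  assumes "\<beta> \<in> hom (free_Abelian_group ex) (dual_group B)" "k \<in> ex" "k' \<notin> B"
  shows "Poly_Mapping.lookup (\<beta> (frag_of k)) (Dual k') = 0"
proof -
  have "\<beta> (frag_of k) \<in> carrier (dual_group B)"
    using assms by (intro hom_in_carrier[OF assms(1)]) (simp add: keys_frag_of)
  then have "Poly_Mapping.keys (\<beta> (frag_of k)) \<subseteq> Dual ` B" by (simp add: dual_group_def)
  with assms(3) have "Dual k' \<notin> Poly_Mapping.keys (\<beta> (frag_of k))" by blast
  then show ?thesis by (simp only: not_in_keys_iff_lookup_eq_zero)
qed

lemma mu_bar_keys:
  assumes "Poly_Mapping.keys v \<subseteq> mutate_set k k' S" "k \<in> S"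
  shows "Poly_Mapping.keys (mu_bar \<beta> k k' v) \<subseteq> S"
proof -
  have "Poly_Mapping.keys (mu_bar \<beta> k k' v)
      \<subseteq> (\<Union>b\<in>Poly_Mapping.keys v. Poly_Mapping.keys (if b = k' then - frag_of k
     else frag_of b + frag_cmul (max (beta_form \<beta> (frag_of k) (frag_of b)) 0) (frag_of k)))"
    unfolding mu_bar_def by (rule keys_frag_extend)
  also have "\<dots> \<subseteq> S"
  proof (rule UN_least)
    fix b assume "b \<in> Poly_Mapping.keys v"
    then have b: "b = k' \<or> b \<in> S" using assms(1) by (auto simp: mutate_set_def)
    have sub: "Poly_Mapping.keys (frag_of b + frag_cmul c (frag_of k)) \<subseteq> {b, k}" for c
    proof -
      have "Poly_Mapping.keys (frag_of b + frag_cmul c (frag_of k))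
          \<subseteq> Poly_Mapping.keys (frag_of b) \<union> Poly_Mapping.keys (frag_cmul c (frag_of k))"
        by (rule Poly_Mapping.keys_add)
      also have "\<dots> \<subseteq> {b} \<union> {k}"
        by (intro Un_mono) (use keys_cmul[of c "frag_of k"] in \<open>simp_all add: keys_frag_of\<close>)
      finally show ?thesis by blast
    qed
    show "Poly_Mapping.keys (if b = k' then - frag_of k
       else frag_of b + frag_cmul (max (beta_form \<beta> (frag_of k) (frag_of b)) 0) (frag_of k)) \<subseteq> S"
    proof (cases "b = k'")
      case True
      then show ?thesis using assms(2) by (simp add: keys_frag_of)
    next
      case False
      with b assms(2) have "{b, k} \<subseteq> S" by simp
      from subset_trans[OF sub this] False show ?thesis by simp
    qed
  qed
  finally show ?thesis .
qed

lemma beta_form_mutate: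
  assumes \<beta>: "\<beta> \<in> hom (free_Abelian_group ex) (dual_group B)" "skew_symmetrizable ex \<beta>"
    and k: "k \<in> ex" "ex \<subseteq> B" "k' \<notin> B"
    and v: "v \<in> carrier (free_Abelian_group (mutate_set k k' ex))"
    and w: "w \<in> carrier (free_Abelian_group (mutate_set k k' B))"
  shows "beta_form (mutate_beta \<beta> k k') v w = beta_form \<beta> (mu_bar \<beta> k k' v) (mu_bar \<beta> k k' w)"
proof -
  have "mu_bar \<beta> k k' v \<in> carrier (free_Abelian_group ex)"
    using mu_bar_keys[of v k k' ex] v k by simp
  then have "\<beta> (mu_bar \<beta> k k' v) \<in> carrier (dual_group B)"
    by (rule hom_in_carrier[OF \<beta>(1)])
  then have keys: "Poly_Mapping.keys (\<beta> (mu_bar \<beta> k k' v)) \<subseteq> Dual ` B"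
    by (simp add: dual_group_def)
  have "k \<noteq> k'" using k by auto
  have "dual_app (mu_plus_dual \<beta> k k' g) w = dual_app g (mu_bar \<beta> k k' w)"
    if "Poly_Mapping.keys g \<subseteq> Dual ` B" for g
    by (rule dual_app_eqI[where F = "mu_plus_dual \<beta> k k'" and G = "mu_bar \<beta> k k'" and B = B
          and C = "mutate_set k k' B"])
      (use that w k \<open>k \<noteq> k'\<close> in \<open>auto simp: mu_plus_dual_def mu_bar_def frag_extend_diff dual_app_simps
        beta_form_def mutate_set_def beta_diag_zero[OF \<beta>(2)] beta_new_zero[OF \<beta>(1)]\<close>)
  from this[OF keys] show ?thesis
    by (simp add: beta_form_def mutate_beta_def)
qed

lemma mu_bar_dual_keys:
  assumes \<beta>: "\<beta> \<in> hom (free_Abelian_group ex) (dual_group B)"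
    and k: "k \<in> ex" "ex \<subseteq> B"
    and v: "v \<in> carrier (dual_group (mutate_set k k' B))"
  shows "mu_bar_dual \<beta> k k' v \<in> carrier (dual_group B)"
proof -
  have "\<beta> (frag_of k) \<in> carrier (dual_group B)"
    using k by (intro hom_in_carrier[OF \<beta>]) (simp add: keys_frag_of)
  then have *: "Poly_Mapping.keys (\<beta> (frag_of k)) \<subseteq> Dual ` B" by (simp add: dual_group_def)
  have pos: "Poly_Mapping.keys (pos_part (\<beta> (frag_of k))) \<subseteq> Dual ` B"
  proof
    fix d assume "d \<in> Poly_Mapping.keys (pos_part (\<beta> (frag_of k)))"
    then have "d \<in> Poly_Mapping.keys (\<beta> (frag_of k))" by (auto simp: in_keys_iff lookup_pos_part)
    with * show "d \<in> Dual ` B" by auto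
  qed
  have "Poly_Mapping.keys (mu_bar_dual \<beta> k k' v)
      \<subseteq> (\<Union>d\<in>Poly_Mapping.keys v. Poly_Mapping.keys (if d = Dual k'
     then pos_part (\<beta> (frag_of k)) - frag_of (Dual k) else frag_of d))"
    unfolding mu_bar_dual_def by (rule keys_frag_extend)
  also have "\<dots> \<subseteq> Dual ` B"
  proof (rule UN_least)
    fix d assume "d \<in> Poly_Mapping.keys v"
    then have "d = Dual k' \<or> d \<in> Dual ` B" using v by (auto simp: dual_group_def mutate_set_def)
    then show "Poly_Mapping.keys (if d = Dual k'
       then pos_part (\<beta> (frag_of k)) - frag_of (Dual k) else frag_of d) \<subseteq> Dual ` B"
      using k pos keys_diff[of "pos_part (\<beta> (frag_of k))" "frag_of (Dual k)"]
      by (auto simp: keys_frag_of)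
  qed
  finally show ?thesis by (simp add: dual_group_def)
qed

lemma lambda_form_mutate:
  assumes \<beta>: "\<beta> \<in> hom (free_Abelian_group ex) (dual_group B)" "skew_symmetrizable ex \<beta>"
    and l: "l \<in> hom (dual_group B) (free_Abelian_group B)"
    and k: "k \<in> ex" "ex \<subseteq> B" "k' \<notin> B"
    and v: "v \<in> carrier (dual_group (mutate_set k k' B))"
    and w: "w \<in> carrier (dual_group (mutate_set k k' B))"
  shows "lambda_form (mutate_lambda \<beta> k k' l) v w =
    lambda_form l (mu_bar_dual \<beta> k k' v) (mu_bar_dual \<beta> k k' w)"
proof -
  have "l (mu_bar_dual \<beta> k k' v) \<in> carrier (free_Abelian_group B)"
    using hom_in_carrier[OF l] mu_bar_dual_keys[OF \<beta>(1) k(1,2) v] by blast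
  then have keys: "Poly_Mapping.keys (l (mu_bar_dual \<beta> k k' v)) \<subseteq> B" by simp
  have "k \<noteq> k'" using k by auto
  have "dual_app (mu_bar_dual \<beta> k k' w) x = dual_app w (mu_plus \<beta> k k' x)"
    if "Poly_Mapping.keys x \<subseteq> B" for x
    by (rule dual_app_eqI[where F = "mu_bar_dual \<beta> k k'" and G = "mu_plus \<beta> k k'" and C = B
          and B = "mutate_set k k' B"])
      (use that w k \<open>k \<noteq> k'\<close> in \<open>auto simp: mu_bar_dual_def mu_plus_def frag_extend_diff dual_app_simps
        beta_form_def mutate_set_def dual_group_def beta_diag_zero[OF \<beta>(2)]
        beta_new_zero[OF \<beta>(1)]\<close>)
  from this[OF keys] show ?thesis
    by (simp add: lambda_form_def mutate_lambda_def)
qed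

end

theory Submission
  imports Defs
begin

text \<open>
  The maps \<open>mu_plus\<close> and \<open>mu_bar\<close> are mutually inverse, and the dual maps are their transposes
  (\<open>mu_bar_dual\<close> of \<open>mu_plus\<close>, \<open>mu_plus_dual\<close> of \<open>mu_bar\<close>). So in the pairing of
  \<open>(\<mu>\<^sub>k \<beta>) v\<close> with \<open>(\<mu>\<^sub>k \<lambda>) f\<close> the inner mutations cancel and leave
  \<open>\<beta> (mu_bar v)\<close> paired with \<open>\<lambda> (mu_bar_dual f)\<close>; compatibility of \<open>\<beta>\<close> and \<open>\<lambda>\<close> turns this into
  \<open>mu_bar_dual f\<close> paired with \<open>mu_bar v\<close>, where the mutations cancel again.
\<close>

lemma frag_extend_in_hom:
  assumes "\<And>b. b \<in> S \<Longrightarrow> Poly_Mapping.keys (h b) \<subseteq> T"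
  shows "frag_extend h \<in> hom (free_Abelian_group S) (free_Abelian_group T)"
proof (rule homI)
  fix x assume "x \<in> carrier (free_Abelian_group S)"
  then show "frag_extend h x \<in> carrier (free_Abelian_group T)"
    using keys_frag_extend[of h x] assms by fastforce
qed (simp add: frag_extend_add)

text \<open>Serves the two inverse laws, where multiples with coefficients c and -c have to
  cancel.\<close>

lemma frag_cmul_minus_right: "frag_cmul c (- x) = frag_cmul (- c) x"
  by (rule poly_mapping_eqI) simp

lemma keys_add_cmul_frag_of:
  "Poly_Mapping.keys (x + frag_cmul c (frag_of b)) \<subseteq> insert b (Poly_Mapping.keys x)"
  using Poly_Mapping.keys_add[of x "frag_cmul c (frag_of b)"] keys_cmul[of c "frag_of b"]
  by (auto simp: keys_frag_of)

lemma keys_pos_part: "Poly_Mapping.keys (pos_part v) \<subseteq> Poly_Mapping.keys v"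
  by (auto simp: in_keys_iff lookup_pos_part)

context
  fixes B ex :: "'a set" and \<beta> :: "('a \<Rightarrow>\<^sub>0 int) \<Rightarrow> ('a dual \<Rightarrow>\<^sub>0 int)" and k k' :: 'a
  assumes ex: "ex \<subseteq> B" and k: "k \<in> ex" and k': "k' \<notin> B"
    and hom: "\<beta> \<in> hom (free_Abelian_group ex) (dual_group B)"
    and skew: "skew_symmetrizable ex \<beta>"
begin

lemma new_neq: "k \<noteq> k'"
  using ex k k' by auto

text \<open>\<open>S\<close> is kept free because the mutated \<beta> has its source over the
  mutated \<open>ex\<close>: the instance needed later is \<open>S = ex\<close>, not
  \<open>B\<close>.\<close>

lemma mu_bar_hom:
  assumes "k \<in> S"
  shows "mu_bar \<beta> k k' \<in> hom (free_Abelian_group (mutate_set k k' S)) (free_Abelian_group S)"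
proof (rule homI)
  fix x assume "x \<in> carrier (free_Abelian_group (mutate_set k k' S))"
  then show "mu_bar \<beta> k k' x \<in> carrier (free_Abelian_group S)"
    using mu_bar_keys[of x k k' S \<beta>] assms by simp
qed (simp add: mu_bar_def frag_extend_add)

text \<open>The only basis element that is lost is \<open>k\<close>, and its image involves just
  \<open>k'\<close>, which the mutated set always contains.\<close>

lemma mu_plus_hom:
  "mu_plus \<beta> k k' \<in> hom (free_Abelian_group S) (free_Abelian_group (mutate_set k k' S))"
  unfolding mu_plus_def
proof (rule frag_extend_in_hom)
  fix b assume "b \<in> S"
  then show "Poly_Mapping.keys (if b = k then - frag_of k'
      else frag_of b + frag_cmul (max (beta_form \<beta> (frag_of k) (frag_of b)) 0) (frag_of k'))
    \<subseteq> mutate_set k k' S"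
    using keys_add_cmul_frag_of[of "frag_of b" "max (beta_form \<beta> (frag_of k) (frag_of b)) 0" k']
    by (auto simp: keys_frag_of mutate_set_def)
qed

lemma mu_bar_dual_hom:
  "mu_bar_dual \<beta> k k' \<in> hom (dual_group (mutate_set k k' B)) (dual_group B)"
proof (rule homI)
  fix x assume "x \<in> carrier (dual_group (mutate_set k k' B))"
  then show "mu_bar_dual \<beta> k k' x \<in> carrier (dual_group B)"
    by (rule mu_bar_dual_keys[OF hom k ex])
qed (simp add: dual_group_def mu_bar_dual_def frag_extend_add)

lemma mu_plus_dual_hom:
  "mu_plus_dual \<beta> k k' \<in> hom (dual_group B) (dual_group (mutate_set k k' B))"
  unfolding mu_plus_dual_def dual_group_def
proof (rule frag_extend_in_hom)
  fix d assume d: "d \<in> Dual ` B"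
  have "\<beta> (frag_of k) \<in> carrier (dual_group B)"
    using k by (intro hom_in_carrier[OF hom]) (simp add: keys_frag_of)
  \<comment> \<open>\<open>k\<close> leaves the basis, so its dual must not occur in the positive
    part. Skew-symmetry supplies this: the diagonal coefficient of \<beta> at \<open>k\<close> is
    zero.\<close>
  moreover have "Dual k \<notin> Poly_Mapping.keys (pos_part (\<beta> (frag_of k)))"
    using beta_diag_zero[OF skew k] by (simp add: in_keys_iff lookup_pos_part)
  ultimately have "Poly_Mapping.keys (pos_part (\<beta> (frag_of k))) \<subseteq> Dual ` mutate_set k k' B"
    using keys_pos_part[of "\<beta> (frag_of k)"] by (fastforce simp: dual_group_def mutate_set_def)
  then show "Poly_Mapping.keys (if d = Dual k then pos_part (\<beta> (frag_of k)) - frag_of (Dual k')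
      else frag_of d) \<subseteq> Dual ` mutate_set k k' B"
    using d keys_diff[of "pos_part (\<beta> (frag_of k))" "frag_of (Dual k')"]
    by (auto simp: keys_frag_of mutate_set_def)
qed

text \<open>For a basis element b other than \<open>k\<close>, \<open>mu_bar\<close> adds a multiple
  of \<open>k\<close> to b and turns the multiple of \<open>k'\<close> into the opposite multiple of
  \<open>k\<close>. Since \<open>k'\<close> is outside \<open>B\<close>, b itself never meets the
  special case of \<open>mu_bar\<close>.\<close>

lemma mu_bar_mu_plus:
  assumes "Poly_Mapping.keys x \<subseteq> B"
  shows "mu_bar \<beta> k k' (mu_plus \<beta> k k' x) = x"
  using assms
  by (induction x rule: frag_induction)
    (use k' in \<open>auto simp: mu_plus_def mu_bar_def frag_extend_diff frag_extend_add frag_extend_minus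
      frag_extend_cmul
      frag_cmul_minus_right frag_cmul_distrib[symmetric]\<close>)

text \<open>The same cancellation, now between multiples of \<open>k'\<close>. It needs every old
  basis element to differ from \<open>k\<close>, which the mutated set guarantees.\<close>

lemma mu_plus_mu_bar:
  assumes "Poly_Mapping.keys v \<subseteq> mutate_set k k' B"
  shows "mu_plus \<beta> k k' (mu_bar \<beta> k k' v) = v"
  using assms
  by (induction v rule: frag_induction)
    (use new_neq in \<open>auto simp: mu_plus_def mu_bar_def frag_extend_diff frag_extend_add
      frag_extend_minus frag_extend_cmul
      frag_cmul_minus_right frag_cmul_distrib[symmetric] mutate_set_def\<close>)

text \<open>On bases, only the dual of \<open>k'\<close> is not immediate. Against c both sides give
  the positive part of the coefficient of \<beta> at (\<open>k\<close>, c) if c is not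
  \<open>k\<close>, and -1 if c is \<open>k\<close>; the latter uses the zero diagonal.\<close>

lemma mu_bar_dual_adjoint:
  assumes "f \<in> carrier (dual_group (mutate_set k k' B))" "Poly_Mapping.keys x \<subseteq> B"
  shows "dual_app (mu_bar_dual \<beta> k k' f) x = dual_app f (mu_plus \<beta> k k' x)"
  by (rule dual_app_eqI[where C = B and B = "mutate_set k k' B"])
    (use assms k k' new_neq in \<open>auto simp: mu_bar_dual_def mu_plus_def frag_extend_diff
      dual_app_simps beta_form_def mutate_set_def dual_group_def beta_diag_zero[OF skew]
      beta_new_zero[OF hom]\<close>)

lemma compatible_mutate:
  assumes l: "l \<in> hom (dual_group B) (free_Abelian_group B)"
    and comp: "compatible B ex \<beta> l"
  shows "compatible (mutate_set k k' B) (mutate_set k k' ex)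
    (mutate_beta \<beta> k k') (mutate_lambda \<beta> k k' l)"
  unfolding compatible_def
proof (intro ballI)
  fix v f
  assume v: "v \<in> carrier (free_Abelian_group (mutate_set k k' ex))"
    and f: "f \<in> carrier (dual_group (mutate_set k k' B))"
  define u where "u = mu_bar \<beta> k k' v"
  define g where "g = mu_bar_dual \<beta> k k' f"
  have u: "u \<in> carrier (free_Abelian_group ex)"
    unfolding u_def by (rule hom_in_carrier[OF mu_bar_hom[OF k] v])
  have g: "g \<in> carrier (dual_group B)"
    unfolding g_def by (rule hom_in_carrier[OF mu_bar_dual_hom f])
  have lg: "l g \<in> carrier (free_Abelian_group B)"
    by (rule hom_in_carrier[OF l g])
  \<comment> \<open>The inverse law is stated over the mutated \<open>B\<close>, while
    \<open>v\<close> lives over the mutated \<open>ex\<close>.\<close>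
  have vB: "Poly_Mapping.keys v \<subseteq> mutate_set k k' B"
    using v ex by (auto simp: mutate_set_def)
  have "transpose_map (mutate_lambda \<beta> k k' l) (mutate_beta \<beta> k k' v) f
      = beta_form (mutate_beta \<beta> k k') v (mu_plus \<beta> k k' (l g))"
    by (simp add: transpose_map_def beta_form_def mutate_lambda_def g_def)
  \<comment> \<open>The second argument has to lie over the mutated \<open>B\<close>;
    \<open>mu_plus_hom\<close> ensures it.\<close>
  also have "\<dots> = beta_form \<beta> u (mu_bar \<beta> k k' (mu_plus \<beta> k k' (l g)))"
    unfolding u_def
    by (rule beta_form_mutate[OF hom skew k ex k' v hom_in_carrier[OF mu_plus_hom lg]])
  also have "\<dots> = dual_app (\<beta> u) (l g)"
    using lg by (simp add: mu_bar_mu_plus beta_form_def)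
  also have "\<dots> = dual_app g u"
    using comp u g by (simp add: compatible_def transpose_map_def evaluation_def)
  also have "\<dots> = dual_app f (mu_plus \<beta> k k' u)"
    unfolding g_def using f u ex by (intro mu_bar_dual_adjoint) auto
  also have "\<dots> = evaluation v f"
    by (simp add: u_def mu_plus_mu_bar[OF vB] evaluation_def)
  finally show "transpose_map (mutate_lambda \<beta> k k' l) (mutate_beta \<beta> k k' v) f = evaluation v f" .
qed

end

theorem lemma4p20:
  fixes B ex :: "'a set"
    and \<beta> :: "('a \<Rightarrow>\<^sub>0 int) \<Rightarrow> ('a dual \<Rightarrow>\<^sub>0 int)"
    and l :: "('a dual \<Rightarrow>\<^sub>0 int) \<Rightarrow> ('a \<Rightarrow>\<^sub>0 int)"
    and k k' :: 'a
  assumes "countable B"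
    and "ex \<subseteq> B"
    and "\<beta> \<in> hom (free_Abelian_group ex) (dual_group B)"
    and "skew_symmetrizable ex \<beta>"
    and "l \<in> hom (dual_group B) (free_Abelian_group B)"
    and "skew_symmetric B l"
    and "compatible B ex \<beta> l"
    and "k \<in> ex"
    and "k' \<notin> B"
  shows "mutate_beta \<beta> k k' \<in>
           hom (free_Abelian_group (mutate_set k k' ex)) (dual_group (mutate_set k k' B)) \<and>
         mutate_lambda \<beta> k k' l \<in>
           hom (dual_group (mutate_set k k' B)) (free_Abelian_group (mutate_set k k' B)) \<and>
         compatible (mutate_set k k' B) (mutate_set k k' ex)
           (mutate_beta \<beta> k k') (mutate_lambda \<beta> k k' l)"
proof (intro conjI)
  show "mutate_beta \<beta> k k' \<in>
      hom (free_Abelian_group (mutate_set k k' ex)) (dual_group (mutate_set k k' B))"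
    unfolding mutate_beta_def using assms
    by (intro hom_compose[OF mu_bar_hom] hom_compose[OF _ mu_plus_dual_hom])
  show "mutate_lambda \<beta> k k' l \<in>
      hom (dual_group (mutate_set k k' B)) (free_Abelian_group (mutate_set k k' B))"
    unfolding mutate_lambda_def using assms
    by (intro hom_compose[OF mu_bar_dual_hom] hom_compose[OF _ mu_plus_hom])
  show "compatible (mutate_set k k' B) (mutate_set k k' ex)
      (mutate_beta \<beta> k k') (mutate_lambda \<beta> k k' l)"
    using assms by (intro compatible_mutate)
qed

end
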